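(* Let $W=(w_{i,j})\in\mathbb{R}_+^{n\times k}$, $\ell\in\mathbb{R}_+^k$, and for $j\in[k]$ let $f_j:\{0,1\}^n\to\mathbb{R}$ be $f_j(z)=\max\{\ell_j,\max_{i\in[n]}\{w_{i,j}z_i\}\}$. Then $$\mathrm{conv}(\mathcal{M}(W,\ell,0))=\{(y,z)\in\mathbb{R}^k\times[0,1]^n:\ (y_j,\mathbf 1-z)\in\mathrm{conv}(Q_{f_j}),\ \forall j\in[k]\},$$ i.e., the convex hull of $\mathcal{M}(W,\ell,0)$ is given by the extremal polymatroid inequalities of the submodular functions $f_j$ (together with $z\in[0,1]^n$).
   Context: $n,k\ge1$ are integers, $[n]=\{1,\dots,n\}$, $\mathbf 1$ is the all-ones vector. $\mathcal{M}(W,\ell,0)=\{(y,z)\in\mathbb{R}^k\times\{0,1\}^n:\ y_j+w_{i,j}z_i\ge w_{i,j}\ \forall i\in[n],j\in[k];\ y_j\ge\ell_j\ \forall j\in[k]\}$. For $f:\{0,1\}^n\to\mathbb{R}$, $Q_f=\{(y,z)\in\mathbb{R}\times\{0,1\}^n: y\ge f(z)\}$. Identify $V\subseteq[n]$ with its characteristic vector, so $f(V)=f(\mathbf 1_V)$; $f$ is submodular if $f(A)+f(B)\ge f(A\cup B)+f(A\cap B)$ for all $A,B\subseteq[n]$. With $\tilde f=f-f(\emptyset)$, the extended polymatroid is $EP_{\tilde f}=\{\pi\in\mathbb{R}^n:\sum_{i\in V}\pi_i\le\tilde f(V)\ \forall V\subseteq[n]\}$. For submodular $f$, the extremal polymatroid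 inequalities of $f$ are $y\ge\pi^\top z+f(\emptyset)$ for $\pi$ an extreme point of $EP_{\tilde f}$; here they are applied to the point $(y_j,\mathbf 1-z)$ with $f=f_j$. *)

theory Defs
  imports "HOL-Analysis.Analysis"
begin

text \<open>
  The index sets [n] and [k] are finite types 'n and 'k.  A function on {0,1}^n is given by a
  function on \<^typ>\<open>real ^ 'n\<close> of which only the values at binary vectors are ever used.
  The vector \<open>1 :: real ^ 'n\<close> is the all-ones vector.
\<close>

definition binary_vectors :: "(real ^ 'n) set" where
  "binary_vectors = {z. \<forall>i. z $ i \<in> {0, 1}}"

definition char_vec :: "'n set \<Rightarrow> real ^ 'n" where
  "char_vec V = (\<chi> i. indicator V i)"

definition mixing_set :: "real ^ 'k ^ 'n \<Rightarrow> real ^ 'k \<Rightarrow> ((real ^ 'k) \<times> (real ^ 'n)) set" where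
  "mixing_set W l =
    {(y, z). z \<in> binary_vectors \<and>
             (\<forall>i j. y $ j + W $ i $ j * z $ i \<ge> W $ i $ j) \<and>
             (\<forall>j. y $ j \<ge> l $ j)}"

definition Q :: "(real ^ 'n \<Rightarrow> real) \<Rightarrow> (real \<times> (real ^ 'n)) set" where
  "Q f = {(y, z). z \<in> binary_vectors \<and> y \<ge> f z}"

definition submodular :: "(real ^ 'n \<Rightarrow> real) \<Rightarrow> bool" where
  "submodular f \<longleftrightarrow>
    (\<forall>A B. f (char_vec A) + f (char_vec B) \<ge> f (char_vec (A \<union> B)) + f (char_vec (A \<inter> B)))"

definition extended_polymatroid :: "(real ^ 'n \<Rightarrow> real) \<Rightarrow> (real ^ 'n) set" where
  "extended_polymatroid g = {\<pi>. \<forall>V. (\<Sum>i\<in>V. \<pi> $ i) \<le> g (char_vec V)}"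

definition normalized :: "(real ^ 'n \<Rightarrow> real) \<Rightarrow> real ^ 'n \<Rightarrow> real" where
  "normalized f = (\<lambda>z. f z - f (char_vec {}))"

definition satisfies_extremal_polymatroid_ineqs ::
    "(real ^ 'n \<Rightarrow> real) \<Rightarrow> real \<Rightarrow> real ^ 'n \<Rightarrow> bool" where
  "satisfies_extremal_polymatroid_ineqs f y z \<longleftrightarrow>
    (\<forall>\<pi>. \<pi> extreme_point_of extended_polymatroid (normalized f) \<longrightarrow>
          y \<ge> \<pi> \<bullet> z + f (char_vec {}))"

end

theory Submission
  imports Defs
begin

text \<open>
  Substituting \<open>x = 1 - z\<close> turns the constraints of the mixing set into \<open>y\<^sub>j \<ge> f\<^sub>j x\<close>, so the mixing set
  is the joint epigraph of the \<open>f\<^sub>j\<close> over the binary vectors.  Each \<open>f\<^sub>j\<close> is a maximum of a constant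
  and of weights of the chosen indices, hence submodular.

  Two inclusions are easy: the hull of the joint epigraph lies in the intersection of the hulls
  of the single epigraphs, and each of these satisfies the polymatroid inequalities.  The
  content is in closing the cycle: a point \<open>(y, z)\<close> that satisfies all extremal polymatroid
  inequalities lies in the hull of the joint epigraph.  The reason is that Edmonds' greedy algorithm
  looks only at the order of the coordinates of \<open>x\<close>, and not at \<open>f\<^sub>j\<close>.  Sorting the coordinates
  gives one chain of sets \<open>S\<^sub>m\<close> and one expression of \<open>x\<close> as a convex combination
  \<open>\<Sum>m. \<mu>\<^sub>m 1\<^bsub>S\<^sub>m\<^esub>\<close> (lemma \<open>chain_decomposition\<close>).  For each \<open>j\<close> the greedy vector \<open>\<pi>\<close> of the chain is an
  extreme point of the extended polymatroid, and it is tight on the whole chain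
  (\<open>greedy_extreme_point\<close>), so its inequality reads \<open>y\<^sub>j \<ge> \<Sum>m. \<mu>\<^sub>m f\<^sub>j S\<^sub>m\<close>.  Since the multipliers
  \<open>\<mu>\<^sub>m\<close> are the same for all \<open>j\<close>, these bounds together exhibit \<open>(y, z)\<close> as a convex combination of
  points of the joint epigraph.
\<close>

section \<open>The greedy extreme point of an extended polymatroid\<close>

lemma char_vec_binary: "char_vec V \<in> binary_vectors"
  by (auto simp: char_vec_def binary_vectors_def indicator_def)

lemma inner_char_vec: "\<pi> \<bullet> char_vec V = (\<Sum>i\<in>V. \<pi> $ i)"
proof -
  have "\<pi> \<bullet> char_vec V = (\<Sum>i\<in>UNIV. if i \<in> V then \<pi> $ i else 0)"
    unfolding inner_vec_def char_vec_def by (intro sum.cong) (auto simp: indicator_def)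
  then show ?thesis by (simp add: sum.If_cases)
qed

lemma binary_imp_char_vec:
  assumes "z \<in> binary_vectors"
  obtains V where "z = char_vec V"
proof
  show "z = char_vec {i. z $ i = 1}"
    using assms by (auto simp: vec_eq_iff char_vec_def binary_vectors_def indicator_def)
qed

lemma extended_polymatroid_le:
  assumes "\<pi> \<in> extended_polymatroid (normalized f)" and "x \<in> binary_vectors"
  shows "\<pi> \<bullet> x + f (char_vec {}) \<le> f x"
proof -
  obtain V where V: "x = char_vec V" using binary_imp_char_vec[OF assms(2)] .
  have "(\<Sum>i\<in>V. \<pi> $ i) \<le> f (char_vec V) - f (char_vec {})"
    using assms(1) by (auto simp: extended_polymatroid_def normalized_def)
  then show ?thesis by (simp add: V inner_char_vec)
qed

text \<open>
  The greedy vector assigns to the \<open>m\<close>-th index the marginal value of adding it to its predecessors.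
  Its sums along the chain telescope.  Marginal values decrease by submodularity, which gives
  membership.  It is extreme because \<open>n\<close> tight constraints along a full chain determine
  every coordinate: in a proper convex combination of two members, both would have to be tight
  along the chain as well.
\<close>

lemma greedy_extreme_point:
  fixes f :: "real ^ 'n \<Rightarrow> real" and e :: "nat \<Rightarrow> 'n"
  assumes sub: "submodular f" and e: "bij_betw e {..<n} UNIV"
  obtains \<pi> where "\<pi> extreme_point_of extended_polymatroid (normalized f)"
    and "\<And>m. m \<le> n \<Longrightarrow> \<pi> \<bullet> char_vec (e ` {..<m}) + f (char_vec {}) = f (char_vec (e ` {..<m}))"
proof -
  define g where "g V = normalized f (char_vec V)" for V
  define S where "S m = e ` {..<m}" for m
  define r where "r = the_inv_into {..<n} e"
  define \<pi> :: "real ^ 'n" where "\<pi> = (\<chi> i. g (S (Suc (r i))) - g (S (r i)))"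
  have g0: "g {} = 0" by (simp add: g_def normalized_def)
  have gsub: "g (A \<union> B) + g (A \<inter> B) \<le> g A + g B" for A B
    using sub by (auto simp: g_def normalized_def submodular_def algebra_simps)
  have inj: "inj_on e {..<n}" and Sn: "S n = UNIV"
    using e by (auto simp: bij_betw_def S_def)
  have pi: "\<pi> $ e m = g (S (Suc m)) - g (S m)" if "m < n" for m
    using that inj by (simp add: \<pi>_def r_def the_inv_into_f_f)
  have S_Suc: "S (Suc m) = insert (e m) (S m)" for m
    by (simp add: S_def lessThan_Suc)
  have e_notin: "e m \<notin> S m" if "m < n" for m
    using that inj by (fastforce simp: S_def inj_on_def)
  have sum_S_Suc: "(\<Sum>i\<in>S (Suc m). v $ i) = v $ e m + (\<Sum>i\<in>S m. v $ i)"
    if "m < n" for m and v :: "real ^ 'n"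
    using e_notin[OF that] by (simp add: S_Suc)
  have tight: "(\<Sum>i\<in>S m. \<pi> $ i) = g (S m)" if "m \<le> n" for m
    using that
  proof (induction m)
    case 0
    then show ?case by (simp add: S_def g0)
  next
    case (Suc m)
    then show ?case by (simp add: sum_S_Suc pi)
  qed
  have le_inter: "(\<Sum>i\<in>V \<inter> S m. \<pi> $ i) \<le> g (V \<inter> S m)" if "m \<le> n" for V m
    using that
  proof (induction m)
    case 0
    then show ?case by (simp add: S_def g0)
  next
    case (Suc m)
    show ?case
    proof (cases "e m \<in> V")
      case True
      \<comment> \<open>adding \<open>e m\<close> to the smaller set \<open>V \<inter> S m\<close> gains at least \<open>\<pi>\<close> of it, its gain over \<open>S m\<close>\<close>
      have "V \<inter> S (Suc m) \<union> S m = S (Suc m)" "V \<inter> S (Suc m) \<inter> S m = V \<inter> S m"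
        using True by (auto simp: S_Suc)
      then have "g (S (Suc m)) + g (V \<inter> S m) \<le> g (V \<inter> S (Suc m)) + g (S m)"
        using gsub[of "V \<inter> S (Suc m)" "S m"] by simp
      moreover have "(\<Sum>i\<in>V \<inter> S (Suc m). \<pi> $ i) = \<pi> $ e m + (\<Sum>i\<in>V \<inter> S m. \<pi> $ i)"
        using True e_notin[of m] Suc.prems by (simp add: S_Suc)
      ultimately show ?thesis using Suc pi[of m] by simp
    next
      case False
      then have "V \<inter> S (Suc m) = V \<inter> S m" by (auto simp: S_Suc)
      then show ?thesis using Suc by simp
    qed
  qed
  have mem: "\<pi> \<in> extended_polymatroid (normalized f)"
    using le_inter[of n] by (simp add: extended_polymatroid_def Sn flip: g_def)
  have "\<pi> \<notin> open_segment a b"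
    if ab: "a \<in> extended_polymatroid (normalized f)" "b \<in> extended_polymatroid (normalized f)" for a b
  proof
    assume "\<pi> \<in> open_segment a b"
    then obtain u where u: "0 < u" "u < 1" "a \<noteq> b" and comb: "\<pi> = (1 - u) *\<^sub>R a + u *\<^sub>R b"
      by (auto simp: in_segment)
    have eq: "(\<Sum>i\<in>S m. a $ i) = (\<Sum>i\<in>S m. b $ i)" if "m \<le> n" for m
    proof -
      let ?a = "\<Sum>i\<in>S m. a $ i" and ?b = "\<Sum>i\<in>S m. b $ i"
      have le: "?a \<le> g (S m)" "?b \<le> g (S m)"
        using ab by (auto simp: extended_polymatroid_def g_def)
      have "g (S m) = (1 - u) * ?a + u * ?b"
        unfolding tight[OF that, symmetric] comb
        by (simp add: sum.distrib sum_distrib_left)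
      then have "(1 - u) * (g (S m) - ?a) + u * (g (S m) - ?b) = 0"
        by (simp add: algebra_simps)
      moreover have "0 \<le> (1 - u) * (g (S m) - ?a)" "0 \<le> u * (g (S m) - ?b)"
        using u le by simp_all
      ultimately have "(1 - u) * (g (S m) - ?a) = 0" "u * (g (S m) - ?b) = 0"
        by linarith+
      then show ?thesis using u by simp
    qed
    have "a $ e m = b $ e m" if "m < n" for m
      using eq[of m] eq[of "Suc m"] that by (simp add: sum_S_Suc)
    moreover have "\<exists>m<n. i = e m" for i
      using Sn by (auto simp: S_def)
    ultimately have "a = b" by (metis vec_eq_iff)
    with u show False by simp
  qed
  with mem have "\<pi> extreme_point_of extended_polymatroid (normalized f)"
    by (simp add: extreme_point_of_def)
  moreover have "\<pi> \<bullet> char_vec (e ` {..<m}) + f (char_vec {}) = f (char_vec (e ` {..<m}))"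
    if "m \<le> n" for m
    using tight[OF that] by (simp add: inner_char_vec S_def g_def normalized_def)
  ultimately show ?thesis by (rule that)
qed

section \<open>Points of the cube as convex combinations of a chain\<close>

lemma decreasing_enumeration:
  fixes x :: "real ^ 'n"
  obtains e :: "nat \<Rightarrow> 'n" where "bij_betw e {..<CARD('n)} UNIV"
    and "\<And>p q. p \<le> q \<Longrightarrow> q < CARD('n) \<Longrightarrow> x $ e q \<le> x $ e p"
proof -
  obtain xs :: "'n list" where xs: "set xs = UNIV" "distinct xs"
    using finite_distinct_list[of "UNIV :: 'n set"] by auto
  define ys where "ys = sort_key (\<lambda>i. - (x $ i)) xs"
  have ys: "set ys = UNIV" "distinct ys" using xs by (simp_all add: ys_def)
  then have len: "length ys = CARD('n)" by (metis distinct_card)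
  have "sorted (map (\<lambda>i. - (x $ i)) ys)" by (simp add: ys_def)
  then have "x $ (ys ! q) \<le> x $ (ys ! p)" if "p \<le> q" "q < CARD('n)" for p q
    using that sorted_nth_mono[of "map (\<lambda>i. - (x $ i)) ys" p q] by (simp add: len)
  moreover have "bij_betw (\<lambda>m. ys ! m) {..<CARD('n)} UNIV"
    using bij_betw_nth[OF ys(2)] ys(1) len by metis
  ultimately show ?thesis using that by blast
qed

text \<open>
  The coefficients are the successive differences of the sorted coordinates of \<open>x\<close>, padded by
  \<open>1\<close> in front and \<open>0\<close> at the end.  Membership in \<open>[0,1]\<^sup>n\<close> makes the first and the last of them nonnegative, and
  summing those \<open>m\<close> whose chain set contains a given index telescopes to its coordinate.
\<close>

lemma chain_decomposition:
  fixes x :: "real ^ 'n"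
  assumes x: "\<forall>i. x $ i \<in> {0..1}"
  obtains e :: "nat \<Rightarrow> 'n" and \<mu> :: "nat \<Rightarrow> real"
  where "bij_betw e {..<CARD('n)} UNIV" and "\<And>m. 0 \<le> \<mu> m"
    and "(\<Sum>m\<le>CARD('n). \<mu> m) = 1"
    and "x = (\<Sum>m\<le>CARD('n). \<mu> m *\<^sub>R char_vec (e ` {..<m}))"
proof -
  let ?n = "CARD('n)"
  obtain e :: "nat \<Rightarrow> 'n" where e: "bij_betw e {..<?n} UNIV"
    and dec: "\<And>p q. p \<le> q \<Longrightarrow> q < ?n \<Longrightarrow> x $ e q \<le> x $ e p"
    using decreasing_enumeration[of x] by metis
  define X where "X m = (if m = 0 then 1 else if m \<le> ?n then x $ e (m - 1) else 0)" for m
  define \<mu> where "\<mu> m = X m - X (Suc m)" for m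
  have inj: "inj_on e {..<?n}" and surj: "e ` {..<?n} = UNIV"
    using e by (auto simp: bij_betw_def)
  have nonneg: "0 \<le> \<mu> m" for m
    using x dec[of "m - 1" m] by (auto simp: \<mu>_def X_def)
  have total: "(\<Sum>m\<le>?n. \<mu> m) = 1"
    unfolding \<mu>_def sum_telescope by (simp add: X_def)
  have coord: "(\<Sum>m\<le>?n. \<mu> m * indicator (e ` {..<m}) (e p)) = x $ e p" if p: "p < ?n" for p
  proof -
    have "e p \<in> e ` {..<m} \<longleftrightarrow> p < m" if "m \<le> ?n" for m
      using p that inj_on_image_mem_iff[OF inj, of p "{..<m}"] by auto
    then have "(\<Sum>m\<le>?n. \<mu> m * indicator (e ` {..<m}) (e p)) = (\<Sum>m\<le>?n. if p < m then \<mu> m else 0)"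
      by (intro sum.cong) (auto simp: indicator_def)
    also have "\<dots> = sum \<mu> {Suc p..?n}"
      by (simp add: sum.If_cases) (rule sum.cong, auto)
    also have "\<dots> = X (Suc p) - X (Suc ?n)"
      using p sum_Suc_diff[of "Suc p" ?n "\<lambda>m. - X m"] by (simp add: \<mu>_def)
    finally show ?thesis using p by (simp add: X_def)
  qed
  have "x $ i = (\<Sum>m\<le>?n. \<mu> m *\<^sub>R char_vec (e ` {..<m})) $ i" for i
  proof -
    obtain p where "p < ?n" "i = e p" using surj by (metis UNIV_I image_iff lessThan_iff)
    then show ?thesis using coord[of p] by (simp add: char_vec_def)
  qed
  then have "x = (\<Sum>m\<le>?n. \<mu> m *\<^sub>R char_vec (e ` {..<m}))" by (simp add: vec_eq_iff)
  with e nonneg total show ?thesis by (rule that)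
qed

section \<open>Convex hulls of epigraphs over the binary vectors\<close>

text \<open>An inequality valid for the epigraph is valid for its hull because it cuts out a halfspace.\<close>

lemma hull_Q_satisfies_polymatroid_ineqs:
  assumes "(t, x) \<in> convex hull (Q f)"
  shows "satisfies_extremal_polymatroid_ineqs f t x"
  unfolding satisfies_extremal_polymatroid_ineqs_def
proof (intro allI impI)
  fix \<pi> assume "\<pi> extreme_point_of extended_polymatroid (normalized f)"
  then have mem: "\<pi> \<in> extended_polymatroid (normalized f)" by (simp add: extreme_point_of_def)
  let ?H = "{p. (- 1, \<pi>) \<bullet> p \<le> - f (char_vec {})}"
  have "Q f \<subseteq> ?H"
  proof
    fix p assume "p \<in> Q f"
    then obtain s v where "p = (s, v)" "v \<in> binary_vectors" "f v \<le> s" by (auto simp: Q_def)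
    with extended_polymatroid_le[OF mem, of v] show "p \<in> ?H" by simp
  qed
  then have "convex hull (Q f) \<subseteq> ?H" by (intro hull_minimal convex_halfspace_le)
  with assms show "t \<ge> \<pi> \<bullet> x + f (char_vec {})" by auto
qed

text \<open>
  The hull of a joint epigraph is in general smaller than the intersection of the single hulls.
  Submodularity closes the gap: the chain and its coefficients come from \<open>x = 1 - z\<close> alone, so
  they serve all \<open>f\<^sub>j\<close> at once.  The slack \<open>y\<^sub>j - \<Sum>m. \<mu>\<^sub>m f\<^sub>j S\<^sub>m\<close>
  is added to every point of the combination, which keeps each of them in the epigraph.
\<close>

lemma polymatroid_ineqs_imp_joint_epigraph_hull:
  fixes f :: "'k::finite \<Rightarrow> real ^ 'n \<Rightarrow> real" and y :: "real ^ 'k" and z :: "real ^ 'n"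
  assumes sub: "\<forall>j. submodular (f j)" and z: "\<forall>i. z $ i \<in> {0..1}"
    and ineqs: "\<forall>j. satisfies_extremal_polymatroid_ineqs (f j) (y $ j) (1 - z)"
  shows "(y, z) \<in> convex hull {(y, z). z \<in> binary_vectors \<and> (\<forall>j. f j (1 - z) \<le> y $ j)}"
    (is "_ \<in> convex hull ?E")
proof -
  let ?n = "CARD('n)"
  have "\<forall>i. (1 - z) $ i \<in> {0..1}" using z by simp
  then obtain e :: "nat \<Rightarrow> 'n" and \<mu> where e: "bij_betw e {..<?n} UNIV"
    and nonneg: "\<And>m. 0 \<le> \<mu> m" and total: "(\<Sum>m\<le>?n. \<mu> m) = 1"
    and comb: "1 - z = (\<Sum>m\<le>?n. \<mu> m *\<^sub>R char_vec (e ` {..<m}))"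
    by (rule chain_decomposition) (rule that)
  define c where "c m = char_vec (e ` {..<m})" for m
  define F where "F m = (\<chi> j. f j (c m))" for m
  define d where "d = y - (\<Sum>m\<le>?n. \<mu> m *\<^sub>R F m)"
  have d_nonneg: "0 \<le> d $ j" for j
  proof -
    obtain \<pi> where ext: "\<pi> extreme_point_of extended_polymatroid (normalized (f j))"
      and tight: "\<And>m. m \<le> ?n \<Longrightarrow> \<pi> \<bullet> c m + f j (char_vec {}) = f j (c m)"
      using greedy_extreme_point[OF sub[rule_format] e] unfolding c_def by metis
    have "(\<Sum>m\<le>?n. \<mu> m * f j (c m)) = (\<Sum>m\<le>?n. \<mu> m * (\<pi> \<bullet> c m + f j (char_vec {})))"
      by (intro sum.cong) (simp_all add: tight)
    also have "\<dots> = (\<Sum>m\<le>?n. \<mu> m * (\<pi> \<bullet> c m)) + (\<Sum>m\<le>?n. \<mu> m) * f j (char_vec {})"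
      by (simp add: distrib_left sum.distrib sum_distrib_right)
    also have "(\<Sum>m\<le>?n. \<mu> m * (\<pi> \<bullet> c m)) = \<pi> \<bullet> (1 - z)"
      by (simp add: comb c_def inner_sum_right)
    also have "\<pi> \<bullet> (1 - z) + (\<Sum>m\<le>?n. \<mu> m) * f j (char_vec {}) \<le> y $ j"
      using ineqs ext by (simp add: satisfies_extremal_polymatroid_ineqs_def total)
    finally show ?thesis by (simp add: d_def F_def)
  qed
  have vertex: "(F m + d, 1 - c m) \<in> ?E" for m
  proof -
    have "1 - c m \<in> binary_vectors"
      by (auto simp: binary_vectors_def c_def char_vec_def indicator_def)
    then show ?thesis using d_nonneg by (simp add: F_def)
  qed
  have "(\<Sum>m\<le>?n. \<mu> m *\<^sub>R (F m + d, 1 - c m)) \<in> convex hull ?E"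
    by (rule convex_sum)
      (simp_all only: finite_atMost convex_convex_hull total nonneg hull_inc[OF vertex])
  moreover have "(\<Sum>m\<le>?n. \<mu> m *\<^sub>R (F m + d, 1 - c m)) = (y, z)"
  proof (rule prod_eqI)
    have "(\<Sum>m\<le>?n. \<mu> m *\<^sub>R (F m + d)) = (\<Sum>m\<le>?n. \<mu> m *\<^sub>R F m) + (\<Sum>m\<le>?n. \<mu> m) *\<^sub>R d"
      by (simp add: scaleR_add_right sum.distrib scaleR_sum_left)
    then show "fst (\<Sum>m\<le>?n. \<mu> m *\<^sub>R (F m + d, 1 - c m)) = fst (y, z)"
      by (simp add: fst_sum total d_def)
    have "(\<Sum>m\<le>?n. \<mu> m *\<^sub>R (1 - c m)) = (\<Sum>m\<le>?n. \<mu> m) *\<^sub>R 1 - (1 - z)"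
      by (simp add: comb c_def scaleR_diff_right sum_subtractf scaleR_sum_left)
    then show "snd (\<Sum>m\<le>?n. \<mu> m *\<^sub>R (F m + d, 1 - c m)) = snd (y, z)"
      by (simp add: snd_sum total)
  qed
  ultimately show ?thesis by simp
qed

text \<open>
  The right-hand side is convex because \<open>(y, z) \<mapsto> (y\<^sub>j, 1 - z)\<close> is affine for each \<open>j\<close>, so containing
  the joint epigraph is enough.
\<close>

lemma joint_epigraph_hull_subset:
  fixes f :: "'k::finite \<Rightarrow> real ^ 'n \<Rightarrow> real"
  shows "convex hull {(y, z). z \<in> binary_vectors \<and> (\<forall>j. f j (1 - z) \<le> y $ j)}
       \<subseteq> {(y, z). (\<forall>i. z $ i \<in> {0..1}) \<and> (\<forall>j. (y $ j, 1 - z) \<in> convex hull (Q (f j)))}"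
    (is "convex hull ?E \<subseteq> ?A")
proof (rule hull_minimal)
  show "?E \<subseteq> ?A"
  proof (clarify, intro conjI allI)
    fix y :: "real ^ 'k" and z :: "real ^ 'n" and i j
    assume z: "z \<in> binary_vectors" and y: "\<forall>j. f j (1 - z) \<le> y $ j"
    have zi: "z $ i \<in> {0, 1}" for i using z by (auto simp: binary_vectors_def)
    show "z $ i \<in> {0..1}" using zi[of i] by auto
    have "1 - z \<in> binary_vectors" using zi by (auto simp: binary_vectors_def)
    then have "(y $ j, 1 - z) \<in> Q (f j)" using y by (simp add: Q_def)
    then show "(y $ j, 1 - z) \<in> convex hull (Q (f j))" by (rule hull_inc)
  qed
  show "convex ?A"
  proof (rule convexI)
    fix p q :: "(real ^ 'k) \<times> (real ^ 'n)" and u v :: real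
    assume "p \<in> ?A" "q \<in> ?A" and uv: "0 \<le> u" "0 \<le> v" "u + v = 1"
    obtain y z y' z' where p: "p = (y, z)" and q: "q = (y', z')" by (metis surj_pair)
    from \<open>p \<in> ?A\<close> \<open>q \<in> ?A\<close> have
      box: "z $ i \<in> {0..1}" "z' $ i \<in> {0..1}" and
      hull: "(y $ j, 1 - z) \<in> convex hull (Q (f j))" "(y' $ j, 1 - z') \<in> convex hull (Q (f j))" for i j
      by (auto simp: p q)
    have "u * z $ i + v * z' $ i \<in> {0..1}" for i
      using convexD[OF convex_real_interval(5) box[of i] uv] by simp
    moreover have "(u * y $ j + v * y' $ j, 1 - (u *\<^sub>R z + v *\<^sub>R z')) \<in> convex hull (Q (f j))" for j
    proof -
      have "1 - (u *\<^sub>R z + v *\<^sub>R z') = u *\<^sub>R (1 - z) + v *\<^sub>R (1 - z')"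
        using uv(3) by (simp add: algebra_simps flip: scaleR_left_distrib)
      then show ?thesis
        using convexD[OF convex_convex_hull hull[of j] uv] by simp
    qed
    ultimately show "u *\<^sub>R p + v *\<^sub>R q \<in> ?A" by (simp add: p q)
  qed
qed

section \<open>The mixing set as a joint epigraph\<close>

lemma max_weight_le_iff:
  fixes w :: "'n::finite \<Rightarrow> real"
  shows "max a (MAX i. w i) \<le> t \<longleftrightarrow> a \<le> t \<and> (\<forall>i. w i \<le> t)"
  by (subst max.bounded_iff, subst Max_le_iff) auto

text \<open>
  A function of this form takes a union to the larger of the two values, while monotonicity bounds
  its value at the intersection by the smaller one.
\<close>

lemma max_weight_submodular:
  fixes f :: "real ^ 'n \<Rightarrow> real" and w :: "'n \<Rightarrow> real"
  assumes w: "\<And>i. 0 \<le> w i"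
    and f: "\<forall>z \<in> binary_vectors. f z = max a (MAX i. w i * z $ i)"
  shows "submodular f"
proof -
  have le_iff: "f (char_vec V) \<le> t \<longleftrightarrow> a \<le> t \<and> (\<forall>i. w i * indicator V i \<le> t)" for V t
    using f char_vec_binary[of V] max_weight_le_iff[of a "\<lambda>i. w i * indicator V i" t]
    by (simp add: char_vec_def)
  have below: "a \<le> f (char_vec V)" "w i * indicator V i \<le> f (char_vec V)" for V i
    using le_iff[of V "f (char_vec V)"] by auto
  have mono: "f (char_vec U) \<le> f (char_vec V)" if "U \<subseteq> V" for U V
  proof -
    have "w i * indicator U i \<le> w i * indicator V i" for i
      using w[of i] that by (auto simp: indicator_def)
    then show ?thesis using below order_trans by (subst le_iff) blast
  qed
  have union: "f (char_vec (A \<union> B)) \<le> max (f (char_vec A)) (f (char_vec B))" for A B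
  proof -
    have "w i * indicator (A \<union> B) i \<le> max (f (char_vec A)) (f (char_vec B))" for i
      using below(2)[of i A] below(2)[of i B]
      by (cases "i \<in> A"; cases "i \<in> B") (auto simp: le_max_iff_disj)
    then show ?thesis using below(1)[of A] by (subst le_iff) (simp add: le_max_iff_disj)
  qed
  show ?thesis
    unfolding submodular_def
  proof (intro allI)
    fix A B :: "'n set"
    show "f (char_vec (A \<union> B)) + f (char_vec (A \<inter> B)) \<le> f (char_vec A) + f (char_vec B)"
      using union[of A B] mono[of "A \<inter> B" A] mono[of "A \<inter> B" B] by (auto simp: max_def split: if_splits)
  qed
qed

lemma mixing_set_eq_joint_epigraph:
  fixes W :: "real ^ 'k ^ 'n" and l :: "real ^ 'k"
  assumes f: "\<forall>j. \<forall>z \<in> binary_vectors. f j z = max (l $ j) (MAX i. W $ i $ j * z $ i)"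
  shows "mixing_set W l = {(y, z). z \<in> binary_vectors \<and> (\<forall>j. f j (1 - z) \<le> y $ j)}"
proof -
  have "(\<forall>j. f j (1 - z) \<le> y $ j) \<longleftrightarrow>
        (\<forall>i j. W $ i $ j \<le> y $ j + W $ i $ j * z $ i) \<and> (\<forall>j. l $ j \<le> y $ j)"
    if "z \<in> binary_vectors" for y :: "real ^ 'k" and z :: "real ^ 'n"
  proof -
    have "1 - z \<in> binary_vectors" using that by (auto simp: binary_vectors_def)
    then have "f j (1 - z) \<le> y $ j \<longleftrightarrow> l $ j \<le> y $ j \<and> (\<forall>i. W $ i $ j * (1 - z) $ i \<le> y $ j)" for j
      using f by (simp only: max_weight_le_iff)
    then show ?thesis by (auto simp: algebra_simps)
  qed
  then show ?thesis unfolding mixing_set_def by (simp cong: conj_cong)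
qed

theorem corollary2:
  fixes W :: "real ^ 'k ^ 'n" and l :: "real ^ 'k" and f :: "'k \<Rightarrow> real ^ 'n \<Rightarrow> real"
  assumes "\<forall>i j. W $ i $ j \<ge> 0"
    and "\<forall>j. l $ j \<ge> 0"
    and "\<forall>j. \<forall>z \<in> binary_vectors. f j z = max (l $ j) (MAX i. W $ i $ j * z $ i)"
  shows "convex hull (mixing_set W l) =
           {(y, z). (\<forall>i. z $ i \<in> {0..1}) \<and> (\<forall>j. (y $ j, 1 - z) \<in> convex hull (Q (f j)))}
         \<and> (\<forall>j. submodular (f j))
         \<and> convex hull (mixing_set W l) =
           {(y, z). (\<forall>i. z $ i \<in> {0..1}) \<and>
                    (\<forall>j. satisfies_extremal_polymatroid_ineqs (f j) (y $ j) (1 - z))}"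
    (is "?M = ?A \<and> _ \<and> _ = ?B")
proof -
  have sub: "\<forall>j. submodular (f j)"
  proof
    fix j
    show "submodular (f j)"
      using assms(1) assms(3)[rule_format, of _ j]
      by (intro max_weight_submodular[of "\<lambda>i. W $ i $ j" "f j" "l $ j"]) auto
  qed
  note M = mixing_set_eq_joint_epigraph[OF assms(3)]
  have "?M \<subseteq> ?A" unfolding M by (rule joint_epigraph_hull_subset)
  moreover have "?A \<subseteq> ?B" using hull_Q_satisfies_polymatroid_ineqs by blast
  moreover have "?B \<subseteq> ?M"
    unfolding M using polymatroid_ineqs_imp_joint_epigraph_hull[OF sub] by blast
  ultimately show ?thesis using sub by blast
qed

end
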